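(* Let $H=C_a\square C_b$ be the toroidal grid with $a,b\geq 10$, let $n=ab$, and identify $V(H)$ with $[n]$. Then the set of all straight paths in $H$ with $4$ vertices is a resolving set for the Kneser graph $K(n,4)$. Therefore, for such $n$, $\beta(K(n,4))\leq 2n$.
   Context: The toroidal grid $C_a\square C_b$ has vertex set $\mathbb{Z}_a\times\mathbb{Z}_b$, with $(i,j)$ adjacent to $(i\pm1,j)$ and $(i,j\pm1)$. A straight path with $m$ vertices is a vertex set of the form $\{(i,j),(i+1,j),\dots,(i+m-1,j)\}$ or $\{(i,j),(i,j+1),\dots,(i,j+m-1)\}$ (so there are $2ab$ of them for each fixed $m$ smaller than $a,b$). The Kneser graph $K(n,k)$ has as vertices the $k$-subsets of $[n]$, adjacent when disjoint. A resolving set is a set $\mathcal{S}$ of vertices such that for all distinct vertices $U,W$ some $X\in\mathcal{S}$ has $d(U,X)\neq d(W,X)$; $\beta$ is the minimum size of a resolving set. *)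

theory Defs
  imports "Graph_Theory.Graph_Theory"
begin

text \<open>
  Undirected graphs are represented as symmetric digraphs. The type of pair digraphs
  comes with the coercion \<^const>\<open>with_proj\<close> into general digraphs.
\<close>

definition torus_grid :: "nat \<Rightarrow> nat \<Rightarrow> (int \<times> int) pair_pre_digraph" where
  "torus_grid a b =
    (let V = {0..<int a} \<times> {0..<int b} in
     \<lparr> pverts = V,
       parcs = {((i, j), v) | i j v. (i, j) \<in> V \<and>
         v \<in> {((i + 1) mod int a, j), ((i - 1) mod int a, j),
              (i, (j + 1) mod int b), (i, (j - 1) mod int b)}} \<rparr>)"

definition straight_paths :: "nat \<Rightarrow> nat \<Rightarrow> nat \<Rightarrow> (int \<times> int) set set" where
  "straight_paths a b m =
    (\<Union>(i, j) \<in> pverts (torus_grid a b).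
      {(\<lambda>t. ((i + int t) mod int a, j)) ` {..<m},
       (\<lambda>t. (i, (j + int t) mod int b)) ` {..<m}})"

definition kneser_graph :: "nat \<Rightarrow> nat \<Rightarrow> nat set pair_pre_digraph" where
  "kneser_graph n k =
    (let V = {A. A \<subseteq> {1..n} \<and> card A = k} in
     \<lparr> pverts = V, parcs = {(A, B). A \<in> V \<and> B \<in> V \<and> A \<inter> B = {}} \<rparr>)"

lemma wf_digraph_torus_grid: "wf_digraph (torus_grid a b)"
  by unfold_locales (auto simp: torus_grid_def Let_def)

lemma symmetric_torus_grid: "symmetric (torus_grid a b)"
  by (auto simp: symmetric_def sym_def torus_grid_def Let_def mod_simps)

lemma wf_digraph_kneser_graph: "wf_digraph (kneser_graph n k)"
  by unfold_locales (auto simp: kneser_graph_def Let_def)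

lemma symmetric_kneser_graph: "symmetric (kneser_graph n k)"
  by (auto simp: symmetric_def sym_def kneser_graph_def Let_def)

text \<open>
  The graph distance is the minimum cost of a walk when all arcs have cost one;
  it is infinite between vertices in different components.
\<close>

definition graph_dist :: "('a, 'b) pre_digraph \<Rightarrow> 'a \<Rightarrow> 'a \<Rightarrow> ereal" where
  "graph_dist G u v = wf_digraph.\<mu> G (\<lambda>_. 1) u v"

definition resolving_set :: "('a, 'b) pre_digraph \<Rightarrow> 'a set \<Rightarrow> bool" where
  "resolving_set G S \<longleftrightarrow> S \<subseteq> verts G \<and>
    (\<forall>u \<in> verts G. \<forall>w \<in> verts G. u \<noteq> w \<longrightarrow>
      (\<exists>x \<in> S. graph_dist G u x \<noteq> graph_dist G w x))"

text \<open>
  For a finite graph the minimum exists, since the set of all vertices is resolving.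
\<close>

definition metric_dimension :: "('a, 'b) pre_digraph \<Rightarrow> nat" where
  "metric_dimension G = (LEAST k. \<exists>S. finite S \<and> resolving_set G S \<and> card S = k)"

end

theory Submission
  imports Defs
begin

text \<open>
  Distance one in the Kneser graph means disjointness, so \<open>U\<close> and \<open>W\<close> are resolved as soon as
  some straight path meets exactly one of them. Suppose that there is no such path and let
  \<open>u \<in> U - W\<close>. The four straight paths that start or end at \<open>u\<close> must all meet \<open>W\<close>, so the four
  elements of \<open>W\<close> lie on the arms of a cross centred at \<open>u\<close>, one on each arm. Such a set
  determines its centre, so \<open>u\<close> is the only element of \<open>U - W\<close>. By symmetry \<open>U\<close> is a cross
  centred at some \<open>w \<in> W\<close>. The arms of that cross perpendicular to the line \<open>uw\<close> avoid \<open>W\<close>,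
  hence yield further elements of \<open>U - W\<close>, a contradiction.
\<close>

section \<open>Distance one in digraphs and in Kneser graphs\<close>

text \<open>With unit costs a walk costs its number of arcs, so the infimum is 1 only if some single
  arc is a walk and the empty walk is not; a loop gives distance 0.\<close>

lemma (in wf_digraph) graph_dist_eq_1_iff:
  "graph_dist G u v = 1 \<longleftrightarrow> u \<noteq> v \<and> (u, v) \<in> arcs_ends G"
proof (cases "u \<noteq> v \<and> (u, v) \<in> arcs_ends G")
  case True
  then obtain e where e: "e \<in> arcs G" "tail G e = u" "head G e = v"
    by (auto simp: arcs_ends_conv)
  then have "awalk u [e] v"
    using arc_implies_awalk by blast
  then have "\<mu> (\<lambda>_. 1) u v \<le> 1"
    using min_cost_le_walk_cost[of u "[e]" v "\<lambda>_. 1"] by (simp add: one_ereal_def)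
  moreover have "1 \<le> \<mu> (\<lambda>_. 1) u v"
    unfolding \<mu>_def
  proof (rule INF_greatest)
    fix p assume "p \<in> {p. awalk u p v}"
    then have "p \<noteq> []"
      using True by (auto simp: awalk_Nil_iff)
    then show "1 \<le> ereal (awalk_cost (\<lambda>_. 1) p)"
      by (cases p) (auto simp: one_ereal_def awalk_cost_def sum_list_triv)
  qed
  ultimately show ?thesis
    using True by (auto simp: graph_dist_def)
next
  case False
  have "\<mu> (\<lambda>_. 1) u v \<noteq> 1"
  proof (cases "u = v \<and> u \<in> verts G")
    case True
    then have "awalk u [] v"
      unfolding awalk_Nil_iff .
    then have "\<mu> (\<lambda>_. 1) u v \<le> 0"
      using min_cost_le_walk_cost[of u "[]" v "\<lambda>_. 1"] by (simp add: zero_ereal_def)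
    then show ?thesis
      by (auto simp: zero_ereal_def one_ereal_def)
  next
    case no_Nil: False
    have "2 \<le> \<mu> (\<lambda>_. 1) u v"
      unfolding \<mu>_def
    proof (rule INF_greatest)
      fix p assume "p \<in> {p. awalk u p v}"
      then have p: "awalk u p v" by simp
      with no_Nil have "p \<noteq> []" by (auto simp: awalk_Nil_iff)
      \<comment> \<open>A one-arc walk puts \<open>(u, v)\<close> into \<open>arcs_ends G\<close>,
        so the failing case forces \<open>u = v\<close>, a vertex, which \<open>no_Nil\<close>
        excludes.\<close>
      moreover have "p \<noteq> [e]" for e
        using p False no_Nil by (auto simp: awalk_simps arcs_ends_conv)
      ultimately obtain e f q where "p = e # f # q"
        by (metis neq_Nil_conv)
      then show "2 \<le> ereal (awalk_cost (\<lambda>_. 1) p)"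
        by (simp add: awalk_cost_def sum_list_triv)
    qed
    then show ?thesis
      by (auto simp: one_ereal_def)
  qed
  with False show ?thesis
    by (auto simp: graph_dist_def)
qed

text \<open>Positivity of \<open>k\<close> rules out the empty set, the only set disjoint from
  itself, so disjoint vertices are distinct.\<close>

lemma kneser_graph_dist_eq_1_iff:
  assumes "A \<in> pverts (kneser_graph n k)" "B \<in> pverts (kneser_graph n k)" "0 < k"
  shows "graph_dist (kneser_graph n k) A B = 1 \<longleftrightarrow> A \<inter> B = {}"
  unfolding wf_digraph.graph_dist_eq_1_iff[OF wf_digraph_kneser_graph]
  using assms by (auto simp: kneser_graph_def Let_def)

section \<open>Straight paths on the torus: shape, size and number\<close>

lemma mod_eq_imp_eq_int:
  fixes x y m :: int
  assumes "x mod m = y mod m" "\<bar>x - y\<bar> < m"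
  shows "x = y"
  using assms dvd_imp_le_int[of "x - y" m] by (auto simp: mod_eq_dvd_iff)

lemma pverts_torus_grid: "pverts (torus_grid a b) = {0..<int a} \<times> {0..<int b}"
  by (simp add: torus_grid_def Let_def)

lemma card_pverts_torus_grid: "card (pverts (torus_grid a b)) = a * b"
  by (simp add: pverts_torus_grid)

text \<open>The start \<open>x\<close> is any integer, since reducing it mod \<open>a\<close> keeps
  the path. A path ending at a given point can thus start at an offset of \<open>-3\<close> with no
  case split on wrapping.\<close>

lemma row_in_straight_paths:
  assumes "0 < a" "y \<in> {0..<int b}"
  shows "(\<lambda>t. ((x + int t) mod int a, y)) ` {..<m} \<in> straight_paths a b m"
  unfolding straight_paths_def pverts_torus_grid using assms
  by (intro UN_I[of "(x mod int a, y)"]) (auto simp: mod_simps)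

lemma column_in_straight_paths:
  assumes "0 < b" "x \<in> {0..<int a}"
  shows "(\<lambda>t. (x, (y + int t) mod int b)) ` {..<m} \<in> straight_paths a b m"
  unfolding straight_paths_def pverts_torus_grid using assms
  by (intro UN_I[of "(x, y mod int b)"]) (auto simp: mod_simps)

lemma straight_paths_subset:
  assumes "P \<in> straight_paths a b m"
  shows "P \<subseteq> pverts (torus_grid a b)"
  using assms by (auto simp: straight_paths_def pverts_torus_grid)

text \<open>The bounds on \<open>m\<close> keep a path from wrapping onto itself: offsets below
  \<open>m\<close> differ by less than either cycle length.\<close>

lemma card_straight_path:
  assumes "P \<in> straight_paths a b m" "m \<le> a" "m \<le> b"
  shows "card P = m"
proof -
  have inj: "inj_on (\<lambda>t. (z + int t) mod int c) {..<m}" if "m \<le> c" for z c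
  proof (rule inj_onI)
    fix s t assume *: "s \<in> {..<m}" "t \<in> {..<m}" "(z + int s) mod int c = (z + int t) mod int c"
    then have "z + int s = z + int t"
      using that by (intro mod_eq_imp_eq_int[OF *(3)]) auto
    then show "s = t" by simp
  qed
  have "inj_on (\<lambda>t. ((i + int t) mod int a, j)) {..<m}"
    "inj_on (\<lambda>t. (i, (j + int t) mod int b)) {..<m}" for i j
    using inj[OF assms(2), of i] inj[OF assms(3), of j] by (auto simp: inj_on_def)
  with assms(1) show ?thesis
    by (auto simp: straight_paths_def card_image)
qed

text \<open>Each vertex starts at most two paths, one in its row and one in its column.\<close>

lemma card_straight_paths_le:
  "finite (straight_paths a b m) \<and> card (straight_paths a b m) \<le> 2 * (a * b)"
proof -
  let ?V = "pverts (torus_grid a b)"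
  let ?F = "\<lambda>(i, j). {(\<lambda>t. ((i + int t) mod int a, j)) ` {..<m},
    (\<lambda>t. (i, (j + int t) mod int b)) ` {..<m}}"
  have fin: "finite ?V" by (simp add: pverts_torus_grid)
  have "card (\<Union>v\<in>?V. ?F v) \<le> (\<Sum>v\<in>?V. card (?F v))"
    by (rule card_UN_le[OF fin])
  also have "\<dots> \<le> (\<Sum>v\<in>?V. 2)"
    by (rule sum_mono) (auto simp: card_insert_if)
  finally show ?thesis
    using fin by (auto simp: straight_paths_def card_pverts_torus_grid)
qed

section \<open>Crosses and their centres\<close>

text \<open>On a cycle no order separates the two sides of the centre, so opposite arms are recorded
  only as distinct points.\<close>

definition cross :: "'a \<times> 'b \<Rightarrow> ('a \<times> 'b) set \<Rightarrow> bool" where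
  "cross u W \<longleftrightarrow> (\<exists>x1 x2 y1 y2. distinct [fst u, x1, x2] \<and> distinct [snd u, y1, y2] \<and>
    W = {(x1, snd u), (x2, snd u), (fst u, y1), (fst u, y2)})"

text \<open>The row of the centre is the only row holding two points of a cross, because the points
  off it share a column; likewise for its column.\<close>

lemma cross_center_unique:
  assumes "cross u W" "cross v W"
  shows "u = v"
proof -
  have "y = snd v" if "(x1, y) \<in> W" "(x2, y) \<in> W" "x1 \<noteq> x2" for x1 x2 y
    using assms(2) that by (auto simp: cross_def)
  moreover have "x = fst v" if "(x, y1) \<in> W" "(x, y2) \<in> W" "y1 \<noteq> y2" for x y1 y2
    using assms(2) that by (auto simp: cross_def)
  moreover obtain x1 x2 y1 y2 where "x1 \<noteq> x2" "y1 \<noteq> y2"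
    "(x1, snd u) \<in> W" "(x2, snd u) \<in> W" "(fst u, y1) \<in> W" "(fst u, y2) \<in> W"
    using assms(1) by (fastforce simp: cross_def)
  ultimately show ?thesis
    by (metis prod_eqI)
qed

lemma mutual_crosses_eq:
  assumes "finite U" "finite W" "card U = card W"
    and U: "\<And>u. u \<in> U - W \<Longrightarrow> cross u W"
    and W: "\<And>w. w \<in> W - U \<Longrightarrow> cross w U"
  shows "U = W"
proof (rule ccontr)
  assume "U \<noteq> W"
  with assms(1-3) obtain u w where u: "u \<in> U - W" and w: "w \<in> W - U"
    \<comment> \<open>Finite sets of equal size are equal once one contains the other, so both
      differences are nonempty.\<close>
    by (metis Diff_iff card_subset_eq subsetI)
  obtain x y where xy: "u = (x, y)" by force
  have arms: "i = x \<or> j = y" if "(i, j) \<in> W" for i j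
    using U[OF u] that by (auto simp: cross_def xy)
  have center: "v = (x, y)" if "v \<in> U - W" for v
    using cross_center_unique[OF U[OF that] U[OF u]] xy by simp
  obtain p q where pq: "w = (p, q)" by force
  have "(p, q) \<noteq> (x, y)" and "p = x \<or> q = y"
    using u w arms by (auto simp: xy pq)
  moreover obtain p1 q1 where "p1 \<noteq> p" "q1 \<noteq> q" "(p1, q) \<in> U" "(p, q1) \<in> U"
    using W[OF w] by (fastforce simp: cross_def pq)
  \<comment> \<open>If \<open>q = y\<close> then \<open>p \<noteq> x\<close>, and
    \<open>(p, q1)\<close> is off both lines through \<open>u\<close>, hence in \<open>U - W\<close>
    but different from \<open>u\<close>. If \<open>p = x\<close>, the point \<open>(p1, q)\<close>
    serves instead.\<close>
  ultimately show False
    using arms[of p1 q] arms[of p q1] center[of "(p1, q)"] center[of "(p, q1)"] by blast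
qed

text \<open>
  Only the paths that start or end at the given point are used. The bound \<open>7\<close> keeps the two
  points found on opposite sides, at distance at most \<open>3\<close> each, from coinciding.
\<close>

lemma two_sided_hits:
  fixes x :: int
  assumes "7 \<le> a" "x \<in> {0..<int a}" "x \<notin> R"
    and "\<And>s. x \<in> (\<lambda>t. (s + int t) mod int a) ` {..<4} \<Longrightarrow>
      \<exists>t<4. (s + int t) mod int a \<in> R"
  obtains x1 x2 where "x1 \<in> R" "x2 \<in> R" "distinct [x, x1, x2]"
proof -
  have x: "x mod int a = x" using assms(2) by simp
  have "x \<in> (\<lambda>t. (x + int t) mod int a) ` {..<4}"
    by (rule image_eqI[of _ _ 0]) (simp_all add: x)
  then obtain s where s: "s < 4" "(x + int s) mod int a \<in> R"
    using assms(4) by blast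
  have "x \<in> (\<lambda>t. (x - 3 + int t) mod int a) ` {..<4}"
    by (rule image_eqI[of _ _ 3]) (simp_all add: x)
  then obtain t where t: "t < 4" "(x - 3 + int t) mod int a \<in> R"
    using assms(4) by blast
  have "s \<noteq> 0"
    using s(2) assms(3) x by (intro notI) simp
  moreover have "t \<noteq> 3"
    using t(2) assms(3) x by (intro notI) simp
  ultimately have "(x + int s) mod int a \<noteq> (x - 3 + int t) mod int a"
    using mod_eq_imp_eq_int[of "x + int s" "int a" "x - 3 + int t"] s(1) t(1) assms(1) by auto
  moreover have "(x + int s) mod int a \<noteq> x" and "(x - 3 + int t) mod int a \<noteq> x"
    using s(2) t(2) assms(3) by auto
  ultimately show thesis
    using that s(2) t(2) by auto
qed

text \<open>\<open>two_sided_hits\<close> is applied to the slices of \<open>W\<close> in the row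
  and in the column of \<open>u\<close>, giving two points of \<open>W\<close> in each.\<close>

lemma cross_if_paths_hit:
  assumes "7 \<le> a" "7 \<le> b" "u \<in> pverts (torus_grid a b)" "u \<notin> W" "finite W" "card W = 4"
    and hit: "\<And>P. P \<in> straight_paths a b 4 \<Longrightarrow> u \<in> P \<Longrightarrow> P \<inter> W \<noteq> {}"
  shows "cross u W"
proof -
  obtain x y where u: "u = (x, y)" by force
  have xy: "x \<in> {0..<int a}" "y \<in> {0..<int b}"
    using assms(3) by (auto simp: u pverts_torus_grid)
  obtain x1 x2 where x12: "x1 \<in> {i. (i, y) \<in> W}" "x2 \<in> {i. (i, y) \<in> W}" "distinct [x, x1, x2]"
  proof (rule two_sided_hits[OF assms(1) xy(1)])
    show "x \<notin> {i. (i, y) \<in> W}" using assms(4) by (simp add: u)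
    show "\<exists>t<4. (s + int t) mod int a \<in> {i. (i, y) \<in> W}"
      if "x \<in> (\<lambda>t. (s + int t) mod int a) ` {..<4}" for s
      using hit[OF row_in_straight_paths[of a y b s 4]] that assms(1) xy(2)
      by (fastforce simp: u)
  qed
  obtain y1 y2 where y12: "y1 \<in> {j. (x, j) \<in> W}" "y2 \<in> {j. (x, j) \<in> W}" "distinct [y, y1, y2]"
  proof (rule two_sided_hits[OF assms(2) xy(2)])
    show "y \<notin> {j. (x, j) \<in> W}" using assms(4) by (simp add: u)
    show "\<exists>t<4. (s + int t) mod int b \<in> {j. (x, j) \<in> W}"
      if "y \<in> (\<lambda>t. (s + int t) mod int b) ` {..<4}" for s
      using hit[OF column_in_straight_paths[of b x a s 4]] that assms(2) xy(1)
      by (fastforce simp: u)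
  qed
  \<comment> \<open>The row points have first coordinate different from \<open>x\<close>, so the
    four points are distinct and exhaust \<open>W\<close>.\<close>
  have "{(x1, y), (x2, y), (x, y1), (x, y2)} = W"
    using x12 y12 assms(5,6) by (intro card_subset_eq) auto
  then show ?thesis
    using x12(3) y12(3) by (auto simp: cross_def u)
qed

section \<open>Separation by straight paths and the resolving set\<close>

text \<open>Without a separating path, every path through a point of one set also meets the other.
  Each point in exactly one of the sets is then the centre of a cross formed by the other
  set.\<close>

lemma straight_paths_separate:
  assumes "7 \<le> a" "7 \<le> b" "U \<subseteq> pverts (torus_grid a b)" "W \<subseteq> pverts (torus_grid a b)"
    and "card U = 4" "card W = 4" "U \<noteq> W"
  obtains P where "P \<in> straight_paths a b 4" "(U \<inter> P = {}) \<noteq> (W \<inter> P = {})"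
proof -
  have fin: "finite U" "finite W"
    using assms(5,6) by (auto intro: card_ge_0_finite)
  have "\<exists>P \<in> straight_paths a b 4. (U \<inter> P = {}) \<noteq> (W \<inter> P = {})"
  proof (rule ccontr)
    assume "\<not> ?thesis"
    then have same: "U \<inter> P = {} \<longleftrightarrow> W \<inter> P = {}" if "P \<in> straight_paths a b 4" for P
      using that by auto
    have "U = W"
    proof (rule mutual_crosses_eq)
      fix u assume u: "u \<in> U - W"
      show "cross u W"
      proof (rule cross_if_paths_hit[OF assms(1,2)])
        show "P \<inter> W \<noteq> {}" if "P \<in> straight_paths a b 4" "u \<in> P" for P
          using same[OF that(1)] that(2) u by auto
      qed (use u assms fin in auto)
    next
      fix w assume w: "w \<in> W - U"
      show "cross w U"
      proof (rule cross_if_paths_hit[OF assms(1,2)])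
        show "P \<inter> U \<noteq> {}" if "P \<in> straight_paths a b 4" "w \<in> P" for P
          using same[OF that(1)] that(2) w by auto
      qed (use w assms fin in auto)
    qed (use fin assms in auto)
    with assms(7) show False ..
  qed
  with that show thesis by blast
qed

text \<open>Injectivity of \<open>\<phi>\<close> preserves disjointness and size, so separation on
  the torus carries over to the Kneser graph.\<close>

lemma resolving_set_straight_paths:
  assumes "7 \<le> a" "7 \<le> b" and bij: "bij_betw \<phi> (pverts (torus_grid a b)) {1..n}"
  shows "resolving_set (kneser_graph n 4) ((\<lambda>P. \<phi> ` P) ` straight_paths a b 4)"
proof -
  let ?V = "pverts (torus_grid a b)"
  have inj: "inj_on \<phi> ?V" and img: "\<phi> ` ?V = {1..n}"
    using bij by (auto simp: bij_betw_def)
  have verts: "pverts (kneser_graph n 4) = {A. A \<subseteq> {1..n} \<and> card A = 4}"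
    by (simp add: kneser_graph_def Let_def)
  have path: "\<phi> ` P \<in> pverts (kneser_graph n 4)" if "P \<in> straight_paths a b 4" for P
  proof -
    have P: "P \<subseteq> ?V" "card P = 4"
      using straight_paths_subset[OF that] card_straight_path[OF that] assms by auto
    then have "card (\<phi> ` P) = 4"
      using card_image[OF inj_on_subset[OF inj]] by metis
    then show ?thesis
      using P(1) img by (auto simp: verts)
  qed
  have pull: "\<exists>A0\<subseteq>?V. A = \<phi> ` A0 \<and> card A0 = 4" if "A \<in> pverts (kneser_graph n 4)" for A
  proof -
    have "A \<subseteq> \<phi> ` ?V" "card A = 4"
      using that by (simp_all add: verts img)
    then obtain A0 where A0: "A0 \<subseteq> ?V" "A = \<phi> ` A0"
      by (auto elim: subset_imageE)
    moreover have "card A0 = 4"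
      using card_image[OF inj_on_subset[OF inj A0(1)]] A0(2) \<open>card A = 4\<close> by simp
    ultimately show ?thesis by blast
  qed
  have "\<exists>X \<in> (\<lambda>P. \<phi> ` P) ` straight_paths a b 4.
      graph_dist (kneser_graph n 4) A X \<noteq> graph_dist (kneser_graph n 4) B X"
    if A: "A \<in> pverts (kneser_graph n 4)" and B: "B \<in> pverts (kneser_graph n 4)"
      and "A \<noteq> B" for A B
  proof -
    obtain U where U: "U \<subseteq> ?V" "A = \<phi> ` U" "card U = 4" using pull[OF A] by blast
    obtain W where W: "W \<subseteq> ?V" "B = \<phi> ` W" "card W = 4" using pull[OF B] by blast
    have "U \<noteq> W" using U W \<open>A \<noteq> B\<close> by auto
    then obtain P where P: "P \<in> straight_paths a b 4" "(U \<inter> P = {}) \<noteq> (W \<inter> P = {})"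
      by (rule straight_paths_separate[OF assms(1,2) U(1) W(1) U(3) W(3)])
    have "\<phi> ` C \<inter> \<phi> ` P = {} \<longleftrightarrow> C \<inter> P = {}" if "C \<subseteq> ?V" for C
      using inj_on_image_Int[OF inj that straight_paths_subset[OF P(1)]] by (metis image_is_empty)
    then have "(A \<inter> \<phi> ` P = {}) \<noteq> (B \<inter> \<phi> ` P = {})"
      using P(2) U(1,2) W(1,2) by simp
    \<comment> \<open>Exactly one of the two distances equals 1; the value of the other does not
      matter.\<close>
    then have "graph_dist (kneser_graph n 4) A (\<phi> ` P) \<noteq> graph_dist (kneser_graph n 4) B (\<phi> ` P)"
      using kneser_graph_dist_eq_1_iff[OF A path[OF P(1)]]
        kneser_graph_dist_eq_1_iff[OF B path[OF P(1)]] by auto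
    then show ?thesis using P(1) by blast
  qed
  then show ?thesis
    using path by (auto simp: resolving_set_def)
qed

lemma metric_dimension_le_card:
  assumes "finite S" "resolving_set G S"
  shows "metric_dimension G \<le> card S"
  unfolding metric_dimension_def using assms by (intro Least_le) auto

theorem theorem4p7:
  fixes a b n :: nat
  assumes "a \<ge> 10" and "b \<ge> 10" and "n = a * b"
  shows "(\<forall>\<phi>. bij_betw \<phi> (pverts (torus_grid a b)) {1..n} \<longrightarrow>
            resolving_set (kneser_graph n 4) ((\<lambda>P. \<phi> ` P) ` straight_paths a b 4))
       \<and> metric_dimension (kneser_graph n 4) \<le> 2 * n"
proof (intro conjI allI impI)
  have ab: "7 \<le> a" "7 \<le> b" using assms by auto
  show "resolving_set (kneser_graph n 4) ((\<lambda>P. \<phi> ` P) ` straight_paths a b 4)"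
    if "bij_betw \<phi> (pverts (torus_grid a b)) {1..n}" for \<phi>
    by (rule resolving_set_straight_paths[OF ab that])
  \<comment> \<open>The bound on the dimension requires just one identification, which exists
    because both sets have \<open>a * b\<close> elements.\<close>
  have "\<exists>\<phi>. bij_betw \<phi> (pverts (torus_grid a b)) {1..n}"
    using assms(3) by (intro finite_same_card_bij)
      (simp_all add: card_pverts_torus_grid, simp add: pverts_torus_grid)
  then obtain \<phi> where "bij_betw \<phi> (pverts (torus_grid a b)) {1..n}" ..
  from resolving_set_straight_paths[OF ab this]
  have "metric_dimension (kneser_graph n 4) \<le> card ((\<lambda>P. \<phi> ` P) ` straight_paths a b 4)"
    using card_straight_paths_le by (intro metric_dimension_le_card) blast+
  also have "\<dots> \<le> card (straight_paths a b 4)"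
    using card_straight_paths_le by (intro card_image_le) blast
  also have "\<dots> \<le> 2 * n"
    using card_straight_paths_le assms(3) by blast
  finally show "metric_dimension (kneser_graph n 4) \<le> 2 * n" .
qed

end
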